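(* The Bergman projection $P$ on the Hartogs triangle $\mathbb{H}$ is of weak-type $(4,4)$: there is a constant $C>0$ such that for all $f\in L^4(\mathbb{H})$ and all $\lambda>0$, $$\left|\{z\in\mathbb{H} : |P(f)(z)|>\lambda\}\right| \le \frac{C\,\|f\|^{4}_{L^{4}(\mathbb{H})}}{\lambda^{4}}.$$
   Context: The Hartogs triangle is $\mathbb{H}=\{(z_1,z_2)\in\mathbb{C}^2:|z_1|<|z_2|<1\}$; $dV$ is Lebesgue measure and $|U|$ the Lebesgue measure of $U$. The Bergman projection on $\mathbb{H}$ is $P(f)(z)=\int_{\mathbb{H}}K_{\mathbb{H}}(z;\bar w)f(w)\,dV(w)$ with $$K_{\mathbb{H}}(z_1,z_2;\bar w_1,\bar w_2)=\frac{1}{\pi^2 z_2\bar w_2\left(1-\frac{z_1\bar w_1}{z_2\bar w_2}\right)^2(1-z_2\bar w_2)^2}.$$ *)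

theory Defs
  imports "HOL-Analysis.Analysis"
begin

definition hartogs :: "(complex \<times> complex) set" where
  "hartogs = {(z1, z2). cmod z1 < cmod z2 \<and> cmod z2 < 1}"

definition bergman_kernel_H :: "complex \<times> complex \<Rightarrow> complex \<times> complex \<Rightarrow> complex" where
  "bergman_kernel_H z w =
     (let (z1, z2) = z; (w1, w2) = w in
      1 / (of_real (pi ^ 2) * z2 * cnj w2 * (1 - (z1 * cnj w1) / (z2 * cnj w2)) ^ 2
           * (1 - z2 * cnj w2) ^ 2))"

definition bergman_proj_H :: "(complex \<times> complex \<Rightarrow> complex) \<Rightarrow> complex \<times> complex \<Rightarrow> complex" where
  "bergman_proj_H f z = (LINT w:hartogs|lebesgue. bergman_kernel_H z w * f w)"

definition L4_H :: "(complex \<times> complex \<Rightarrow> complex) \<Rightarrow> bool" where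
  "L4_H f \<longleftrightarrow> set_borel_measurable lebesgue hartogs f \<and>
              set_integrable lebesgue hartogs (\<lambda>w. norm (f w) ^ 4)"

definition L4_norm_pow4 :: "(complex \<times> complex \<Rightarrow> complex) \<Rightarrow> real" where
  "L4_norm_pow4 f = (LINT w:hartogs|lebesgue. norm (f w) ^ 4)"

end

(* In the coordinates z = (u v, v), w = (x s, s), the Hartogs triangle is the product of a disc and a punctured
   disc with measure |v|^2 du dv, and the Bergman kernel becomes 1 / (v cnj s) times the product of
   the Bergman kernels of the two discs. Up to the factor 1 / |v|, the projection is thus dominated
   by the tensor product of two positive Bergman operators. The one in u is bounded on L^4 by a
   Schur test, whereas the one in v, together with the factor 1 / |v|, is of weak type (4,4) for
   the measure |v|^2 dv. A strong type estimate in u followed by a weak type estimate in v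
   combine by Fubini's theorem. *)

theory Submission
  imports Defs "HOL-Complex_Analysis.Cauchy_Integral_Formula"
begin

section \<open>Planar Lebesgue measure\<close>

text \<open>The exponent 4 is critical because 1/|v| lies in weak L^4 but not in L^4 for the measure
  |v|^2 dv: near 0 the integral of |v|^-4 |v|^2 diverges logarithmically, while {1/|v| > t} has
  measure of order t^-4. So the singular factor is accessible only through level sets. Replacing
  kernels by their moduli costs only constants, since the modulus of the disc kernel still gives a
  bounded operator on L^4. No cancellation is used, all estimates take place in
  \<open>ennreal\<close>, and exchanging integrals requires measurability alone. The Jacobian |s|^2
  times the factor 1/|s| of the kernel leaves |s|, which is absorbed into the function on which the
  operator in v acts. Measuring that function in L^4 with weight |s|^-2 turns |s|^4 back into |s|^2,
  so the norm on the Hartogs triangle is recovered without loss. The right-hand side of the weak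
  bound in v is an ordinary integral of a fourth power; it can therefore be integrated over u, and
  the strong bound in u applies afterwards for each s.\<close>

lemma measurable_Complex [measurable (raw)]:
  assumes [measurable]: "f \<in> borel_measurable M" "g \<in> borel_measurable M"
  shows "(\<lambda>x. Complex (f x) (g x)) \<in> borel_measurable M"
  unfolding Complex_eq by measurable

text \<open>Lebesgue measure is determined by its values on boxes, and a complex box is a product of
  intervals along the basis 1, \<i>. This makes one-dimensional affine substitutions available in
  the plane.\<close>

lemma lborel_complex_eq:
  "(lborel :: complex measure) = distr (lborel \<Otimes>\<^sub>M lborel) borel (\<lambda>(x, y). Complex x y)"
proof (rule lborel_eqI)
  fix l u :: complex
  assume le: "\<And>b. b \<in> Basis \<Longrightarrow> l \<bullet> b \<le> u \<bullet> b"
  have l1: "Re l \<le> Re u" "Im l \<le> Im u"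
    using le[of 1] le[of \<i>] by (auto simp: Basis_complex_def)
  have vim: "(\<lambda>(x, y). Complex x y) -` box l u \<inter> space (lborel \<Otimes>\<^sub>M lborel)
      = box (Re l) (Re u) \<times> box (Im l) (Im u)"
    by (auto simp: box_def Basis_complex_def space_pair_measure)
  have "emeasure (distr (lborel \<Otimes>\<^sub>M lborel) borel (\<lambda>(x, y). Complex x y)) (box l u)
     = emeasure (lborel \<Otimes>\<^sub>M lborel) (box (Re l) (Re u) \<times> box (Im l) (Im u))"
    by (subst emeasure_distr) (simp_all add: vim)
  also have "\<dots> = emeasure lborel (box (Re l) (Re u)) * emeasure lborel (box (Im l) (Im u))"
    by (rule lborel.emeasure_pair_measure_Times) auto
  also have "\<dots> = ennreal ((Re u - Re l) * (Im u - Im l))"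
    using l1 by (simp add: ennreal_mult)
  also have "(Re u - Re l) * (Im u - Im l) = (\<Prod>b\<in>Basis. (u - l) \<bullet> b)"
    by (simp add: Basis_complex_def)
  finally show "emeasure (distr (lborel \<Otimes>\<^sub>M lborel) borel (\<lambda>(x, y). Complex x y)) (box l u)
     = ennreal (\<Prod>b\<in>Basis. (u - l) \<bullet> b)" .
qed simp

lemma nn_integral_lborel_complex:
  fixes f :: "complex \<Rightarrow> ennreal"
  assumes [measurable]: "f \<in> borel_measurable borel"
  shows "(\<integral>\<^sup>+z. f z \<partial>lborel) = (\<integral>\<^sup>+x. \<integral>\<^sup>+y. f (Complex x y) \<partial>lborel \<partial>lborel)"
  by (subst lborel_complex_eq, subst nn_integral_distr)
     (simp_all add: lborel.nn_integral_fst[symmetric] split_beta')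

text \<open>With v = a + b\<i>, multiplication by v splits into two one-dimensional substitutions:
  y' = (b/a) x' + ((a^2 + b^2)/a) y at fixed x', then x' = a x - b y at fixed y. Their Jacobians
  multiply to a^2 + b^2. The division by a is the reason for treating a nonzero real part
  separately.\<close>

lemma nn_integral_complex_mult_Re_nonzero:
  fixes f :: "complex \<Rightarrow> ennreal"
  assumes [measurable]: "f \<in> borel_measurable borel" and v: "Re v \<noteq> 0"
  shows "(\<integral>\<^sup>+z. f z \<partial>lborel) = ennreal ((cmod v)\<^sup>2) * (\<integral>\<^sup>+z. f (v * z) \<partial>lborel)"
proof -
  define a b where "a = Re v" and "b = Im v"
  have a: "a \<noteq> 0" using v by (simp add: a_def)
  have n2: "(cmod v)\<^sup>2 = a\<^sup>2 + b\<^sup>2" by (simp add: a_def b_def cmod_power2)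
  have n0: "a\<^sup>2 + b\<^sup>2 > 0" using a by (simp add: sum_power2_gt_zero_iff)
  have E: "v * Complex x y = Complex (a * x - b * y) (b * x + a * y)" for x y
    by (simp add: complex_eq_iff a_def b_def algebra_simps)
  have "(\<integral>\<^sup>+z. f z \<partial>lborel) = (\<integral>\<^sup>+x'. \<integral>\<^sup>+y. f (Complex x' y) \<partial>lborel \<partial>lborel)"
    by (rule nn_integral_lborel_complex) simp
  also have "\<dots> = (\<integral>\<^sup>+x'. ennreal \<bar>(a\<^sup>2 + b\<^sup>2) / a\<bar> *
      (\<integral>\<^sup>+y. f (Complex x' (b / a * x' + (a\<^sup>2 + b\<^sup>2) / a * y)) \<partial>lborel) \<partial>lborel)"
    by (intro nn_integral_cong nn_integral_real_affine) (use n0 a in auto)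
  also have "\<dots> = ennreal \<bar>(a\<^sup>2 + b\<^sup>2) / a\<bar> *
     (\<integral>\<^sup>+x'. \<integral>\<^sup>+y. f (Complex x' (b / a * x' + (a\<^sup>2 + b\<^sup>2) / a * y)) \<partial>lborel \<partial>lborel)"
    by (rule nn_integral_cmult) measurable
  also have "(\<integral>\<^sup>+x'. \<integral>\<^sup>+y. f (Complex x' (b / a * x' + (a\<^sup>2 + b\<^sup>2) / a * y)) \<partial>lborel \<partial>lborel)
     = (\<integral>\<^sup>+y. \<integral>\<^sup>+x'. f (Complex x' (b / a * x' + (a\<^sup>2 + b\<^sup>2) / a * y)) \<partial>lborel \<partial>lborel)"
    by (rule lborel_pair.Fubini') measurable
  also have "\<dots> = (\<integral>\<^sup>+y. ennreal \<bar>a\<bar> * (\<integral>\<^sup>+x. f (Complex (- b * y + a * x)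
      (b / a * (- b * y + a * x) + (a\<^sup>2 + b\<^sup>2) / a * y)) \<partial>lborel) \<partial>lborel)"
    by (intro nn_integral_cong nn_integral_real_affine) (use a in auto)
  also have "\<dots> = ennreal \<bar>a\<bar> * (\<integral>\<^sup>+y. \<integral>\<^sup>+x. f (Complex (- b * y + a * x)
      (b / a * (- b * y + a * x) + (a\<^sup>2 + b\<^sup>2) / a * y)) \<partial>lborel \<partial>lborel)"
    by (rule nn_integral_cmult) measurable
  also have "(\<integral>\<^sup>+y. \<integral>\<^sup>+x. f (Complex (- b * y + a * x)
      (b / a * (- b * y + a * x) + (a\<^sup>2 + b\<^sup>2) / a * y)) \<partial>lborel \<partial>lborel)
      = (\<integral>\<^sup>+y. \<integral>\<^sup>+x. f (v * Complex x y) \<partial>lborel \<partial>lborel)"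
  proof -
    have "Complex (- b * y + a * x) (b / a * (- b * y + a * x) + (a\<^sup>2 + b\<^sup>2) / a * y)
       = v * Complex x y" for x y
      unfolding E using a by (simp add: field_simps power2_eq_square)
    then show ?thesis by simp
  qed
  also have "\<dots> = (\<integral>\<^sup>+x. \<integral>\<^sup>+y. f (v * Complex x y) \<partial>lborel \<partial>lborel)"
    by (rule lborel_pair.Fubini') measurable
  also have "\<dots> = (\<integral>\<^sup>+z. f (v * z) \<partial>lborel)"
    by (rule nn_integral_lborel_complex[symmetric]) measurable
  also have "ennreal \<bar>(a\<^sup>2 + b\<^sup>2) / a\<bar> * (ennreal \<bar>a\<bar> * (\<integral>\<^sup>+z. f (v * z) \<partial>lborel))
     = ennreal ((cmod v)\<^sup>2) * (\<integral>\<^sup>+z. f (v * z) \<partial>lborel)"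
    using a n0 by (simp add: n2 mult.assoc[symmetric] ennreal_mult[symmetric] abs_mult abs_divide)
  finally show ?thesis .
qed

lemma nn_integral_complex_mult:
  fixes f :: "complex \<Rightarrow> ennreal"
  assumes [measurable]: "f \<in> borel_measurable borel" and v: "v \<noteq> 0"
  shows "(\<integral>\<^sup>+z. f z \<partial>lborel) = ennreal ((cmod v)\<^sup>2) * (\<integral>\<^sup>+z. f (v * z) \<partial>lborel)"
proof (cases "Re v = 0")
  case False
  then show ?thesis by (intro nn_integral_complex_mult_Re_nonzero) auto
next
  case True
  \<comment> \<open>both factors of \<open>v = (1 + \<i>) w\<close> have nonzero real part\<close>
  define w where "w = v / (1 + \<i>)"
  have i: "1 + \<i> \<noteq> 0" by (simp add: complex_eq_iff)
  have vw: "v = (1 + \<i>) * w" using i by (simp add: w_def)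
  have "Re w \<noteq> 0"
    using True v by (simp add: w_def Re_divide complex_eq_iff)
  have "(\<integral>\<^sup>+z. f z \<partial>lborel) = ennreal ((cmod (1 + \<i>))\<^sup>2) * (\<integral>\<^sup>+z. f ((1 + \<i>) * z) \<partial>lborel)"
    by (rule nn_integral_complex_mult_Re_nonzero) auto
  also have "(\<integral>\<^sup>+z. f ((1 + \<i>) * z) \<partial>lborel)
     = ennreal ((cmod w)\<^sup>2) * (\<integral>\<^sup>+z. f ((1 + \<i>) * (w * z)) \<partial>lborel)"
    by (rule nn_integral_complex_mult_Re_nonzero) (use \<open>Re w \<noteq> 0\<close> in auto)
  finally show ?thesis
    by (simp add: vw norm_mult power_mult_distrib ennreal_mult mult.assoc)
qed

section \<open>The Poisson integral and averaging over rotations\<close>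

lemma nn_integral_poisson_kernel:
  assumes c: "cmod c < 1"
  shows "(\<integral>\<^sup>+x\<in>{0..1}. ennreal (1 / (cmod (1 - c * cis (2 * pi * x)))\<^sup>2) \<partial>lborel)
     = ennreal (1 / (1 - (cmod c)\<^sup>2))"
proof -
  \<comment> \<open>on the unit circle the Poisson kernel is the real part of \<open>f\<close>, whose mean value is \<open>f 0 = 1\<close>\<close>
  define f where "f z = (1 + c * z) / (1 - c * z)" for z
  have c2: "(cmod c)\<^sup>2 < 1" using c by (simp add: power_less_one_iff abs_square_less_1)
  have nz: "1 - c * z \<noteq> 0" if "cmod z \<le> 1" for z
  proof
    assume "1 - c * z = 0"
    then have "cmod (c * z) = 1" by (metis eq_iff_diff_eq_0 norm_one)
    moreover have "cmod (c * z) \<le> cmod c * 1"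
      unfolding norm_mult using that by (intro mult_left_mono) auto
    ultimately show False using c by simp
  qed
  have "f holomorphic_on cball 0 1"
    unfolding f_def by (intro holomorphic_intros) (use nz in auto)
  then have "((\<lambda>u. f u / (u - 0)) has_contour_integral (2 * of_real pi * \<i> * f 0)) (circlepath 0 1)"
    by (intro Cauchy_integral_circlepath_simple) auto
  then have "((\<lambda>x. f (circlepath 0 1 x) / circlepath 0 1 x * vector_derivative (circlepath 0 1) (at x within {0..1}))
      has_integral (2 * of_real pi * \<i> * f 0)) {0..1}"
    by (simp add: has_contour_integral_def)
  then have "((\<lambda>x. 2 * of_real pi * \<i> * f (cis (2 * pi * x))) has_integral (2 * of_real pi * \<i> * f 0)) {0..1}"
    by (rule has_integral_eq[rotated])
       (simp add: vector_derivative_circlepath01, simp add: circlepath cis_conv_exp mult_ac)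
  from has_integral_mult_right[OF this, of "1 / (2 * of_real pi * \<i>)"]
  have "((\<lambda>x. f (cis (2 * pi * x))) has_integral f 0) {0..1}"
    by simp
  then have "((\<lambda>x. Re (f (cis (2 * pi * x)))) has_integral Re (f 0)) {0..1}"
    by (rule has_integral_Re)
  then have I: "((\<lambda>x. Re (f (cis (2 * pi * x))) / (1 - (cmod c)\<^sup>2)) has_integral 1 / (1 - (cmod c)\<^sup>2)) {0..1}"
    using has_integral_divide[of _ 1] by (simp add: f_def)
  have "Re (f (cis y)) / (1 - (cmod c)\<^sup>2) = 1 / (cmod (1 - c * cis y))\<^sup>2" for y
  proof -
    have 1: "Re (f (cis y)) = Re ((1 + c * cis y) * cnj (1 - c * cis y)) / (cmod (1 - c * cis y))\<^sup>2"
      unfolding f_def by (metis Re_divide_of_real complex_div_cnj of_real_power)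
    have "cmod (c * cis y) = cmod c" by (simp add: norm_mult)
    then have "(cmod c)\<^sup>2 = (Re (c * cis y))\<^sup>2 + (Im (c * cis y))\<^sup>2"
      using cmod_power2[of "c * cis y"] by simp
    then have "Re ((1 + c * cis y) * cnj (1 - c * cis y)) = 1 - (cmod c)\<^sup>2"
      by (simp add: algebra_simps power2_eq_square)
    with 1 c2 show ?thesis by simp
  qed
  with I have I: "((\<lambda>x. 1 / (cmod (1 - c * cis (2 * pi * x)))\<^sup>2) has_integral 1 / (1 - (cmod c)\<^sup>2)) {0..1}"
    by simp
  show ?thesis
    using nn_integral_has_integral_lebesgue[OF _ I] by (simp add: mult.commute indicator_mult_ennreal)
qed

text \<open>The modulus of the Bergman kernel of the unit disc, without its factor 1/\<pi>. Values
  in \<open>ennreal\<close> make every integral against it meaningful.\<close>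

definition disc_kernel :: "complex \<Rightarrow> complex \<Rightarrow> ennreal" where
  "disc_kernel v s = ennreal (1 / (cmod (1 - v * cnj s))\<^sup>2)"

lemma disc_kernel_commute: "disc_kernel v s = disc_kernel s v"
proof -
  have "cmod (1 - v * cnj s) = cmod (cnj (1 - v * cnj s))" by (rule complex_mod_cnj[symmetric])
  also have "cnj (1 - v * cnj s) = 1 - s * cnj v" by (simp add: mult.commute)
  finally show ?thesis by (simp add: disc_kernel_def)
qed

lemma sets_borel_ball [measurable]: "ball (c :: 'a :: metric_space) r \<in> sets borel"
  by (rule borel_open) simp

lemma borel_measurable_cnj [measurable]: "cnj \<in> borel_measurable borel"
  by (intro borel_measurable_continuous_onI continuous_intros)

lemma measurable_disc_kernel [measurable (raw)]:
  assumes [measurable]: "f \<in> borel_measurable M" "g \<in> borel_measurable M"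
  shows "(\<lambda>x. disc_kernel (f x) (g x)) \<in> borel_measurable M"
  unfolding disc_kernel_def by measurable

lemma borel_measurable_cis [measurable]: "cis \<in> borel_measurable borel"
  by (intro borel_measurable_continuous_onI continuous_intros)

text \<open>Rotation invariance allows averaging over \<open>s \<mapsto> cis \<theta> * s\<close>, which turns the kernel into a Poisson integral and replaces polar coordinates.\<close>

lemma nn_integral_disc_kernel_radial:
  fixes h :: "real \<Rightarrow> ennreal"
  assumes [measurable]: "h \<in> borel_measurable borel" and v: "cmod v < 1"
  shows "(\<integral>\<^sup>+s\<in>ball 0 1. h (cmod s) * disc_kernel v s \<partial>lborel)
    = (\<integral>\<^sup>+s\<in>ball 0 1. h (cmod s) * ennreal (1 / (1 - (cmod v)\<^sup>2 * (cmod s)\<^sup>2)) \<partial>lborel)"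
proof -
  define F where "F s = h (cmod s) * disc_kernel v s * indicator (ball 0 1) s" for s
  have [measurable]: "F \<in> borel_measurable borel" unfolding F_def by measurable
  have "(\<integral>\<^sup>+s. F s \<partial>lborel) = (\<integral>\<^sup>+x\<in>{0..1::real}. (\<integral>\<^sup>+s. F s \<partial>lborel) \<partial>lborel)"
    by (simp add: nn_integral_cmult)
  \<comment> \<open>Since \<open>cis\<close> has modulus 1, the Jacobian is 1. The minus sign turns
    into a plus under \<open>cnj\<close>, which yields the Poisson integral with c = v * cnj
    s.\<close>
  also have "\<dots> = (\<integral>\<^sup>+x\<in>{0..1::real}. (\<integral>\<^sup>+s. F (cis (- 2 * pi * x) * s) \<partial>lborel) \<partial>lborel)"
  proof -
    have "(\<integral>\<^sup>+s. F s \<partial>lborel) = (\<integral>\<^sup>+s. F (cis (- 2 * pi * x) * s) \<partial>lborel)" for x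
      by (subst nn_integral_complex_mult[of F "cis (- 2 * pi * x)"]) auto
    then show ?thesis by simp
  qed
  also have "\<dots> = (\<integral>\<^sup>+x. \<integral>\<^sup>+s. F (cis (- 2 * pi * x) * s) * indicator {0..1::real} x \<partial>lborel \<partial>lborel)"
    by (intro nn_integral_cong nn_integral_multc[symmetric]) measurable
  also have "\<dots> = (\<integral>\<^sup>+s. \<integral>\<^sup>+x. F (cis (- 2 * pi * x) * s) * indicator {0..1::real} x \<partial>lborel \<partial>lborel)"
    by (rule lborel_pair.Fubini') measurable
  also have "\<dots> = (\<integral>\<^sup>+s\<in>ball 0 1. h (cmod s) * ennreal (1 / (1 - (cmod v)\<^sup>2 * (cmod s)\<^sup>2)) \<partial>lborel)"
  proof (rule nn_integral_cong)
    fix s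
    have "(\<integral>\<^sup>+x. F (cis (- 2 * pi * x) * s) * indicator {0..1::real} x \<partial>lborel)
      = (\<integral>\<^sup>+x. (h (cmod s) * indicator (ball 0 1) s) *
           (ennreal (1 / (cmod (1 - v * cnj s * cis (2 * pi * x)))\<^sup>2) * indicator {0..1::real} x) \<partial>lborel)"
      by (intro nn_integral_cong) (simp add: F_def disc_kernel_def norm_mult cis_cnj mult_ac indicator_def)
    also have "\<dots> = h (cmod s) * indicator (ball 0 1) s *
           (\<integral>\<^sup>+x\<in>{0..1}. ennreal (1 / (cmod (1 - v * cnj s * cis (2 * pi * x)))\<^sup>2) \<partial>lborel)"
      by (rule nn_integral_cmult) measurable
    also have "\<dots> = h (cmod s) * ennreal (1 / (1 - (cmod v)\<^sup>2 * (cmod s)\<^sup>2)) * indicator (ball 0 1) s"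
    proof (cases "cmod s < 1")
      case True
      have "cmod (v * cnj s) < 1 * 1"
        unfolding norm_mult using v True by (intro mult_strict_mono') auto
      then show ?thesis
        by (subst nn_integral_poisson_kernel) (auto simp: norm_mult power_mult_distrib mult_ac)
    qed simp
    finally show "(\<integral>\<^sup>+x. F (cis (- 2 * pi * x) * s) * indicator {0..1::real} x \<partial>lborel)
      = h (cmod s) * ennreal (1 / (1 - (cmod v)\<^sup>2 * (cmod s)\<^sup>2)) * indicator (ball 0 1) s" .
  qed
  finally show ?thesis by (simp add: F_def)
qed

section \<open>Radial integrals and the Forelli-Rudin estimate\<close>

lemma emeasure_complex_ball:
  "r \<ge> 0 \<Longrightarrow> emeasure lborel (ball (c::complex) r) = ennreal (pi * r\<^sup>2)"
  by (simp add: emeasure_ball unit_ball_vol_2)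

lemma emeasure_complex_cball:
  "r \<ge> 0 \<Longrightarrow> emeasure lborel (cball (c::complex) r) = ennreal (pi * r\<^sup>2)"
  by (simp add: emeasure_cball unit_ball_vol_2)

text \<open>Discs of radius r have area \<pi> r^2, so |s|^2 is uniformly distributed on the unit
  interval with total mass \<pi>. Finite measures agreeing on all rays (x, \<infinity>) coincide,
  and the ray corresponds to an annulus for 0 \<le> x < 1.\<close>

lemma distr_cmod_power2_disc:
  "distr (density lborel (indicator (ball (0::complex) 1))) borel (\<lambda>s. (cmod s)\<^sup>2)
    = density lborel (\<lambda>x. ennreal pi * indicator {0..1::real} x)" (is "?M = ?N")
proof (rule measure_eqI_lessThan)
  have N: "emeasure ?N {x <..} = ennreal pi * emeasure lborel ({0..1} \<inter> {x<..})" for x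
    by (subst emeasure_density)
       (auto simp: nn_integral_cmult mult.assoc indicator_inter_arith[symmetric] simp flip: nn_integral_indicator)
  have M: "emeasure ?M {x <..} = emeasure lborel (ball 0 1 \<inter> {s::complex. (cmod s)\<^sup>2 > x})" for x
    by (subst emeasure_distr, simp, simp, subst emeasure_density)
       (auto simp: vimage_def indicator_inter_arith[symmetric] simp flip: nn_integral_indicator)
  show "emeasure ?M {x <..} = emeasure ?N {x <..}" for x
  proof -
    consider "x < 0" | "0 \<le> x" "x < 1" | "x \<ge> 1" by linarith
    then show ?thesis
    proof cases
      case 1
      then have "ball 0 1 \<inter> {s::complex. (cmod s)\<^sup>2 > x} = ball 0 1" "{0..1} \<inter> {x<..} = {0..1}"
        by (auto intro: less_le_trans)
      then show ?thesis unfolding M N by (simp add: emeasure_complex_ball)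
    next
      case 2
      have "ball 0 1 \<inter> {s::complex. (cmod s)\<^sup>2 > x} = ball 0 1 - cball 0 (sqrt x)"
        using 2 by (auto simp: not_le real_less_lsqrt real_sqrt_less_iff power2_eq_square)
           (metis abs_norm_cancel not_less power2_eq_square real_le_rsqrt real_sqrt_abs real_sqrt_less_iff)+
      moreover have "emeasure lborel (ball 0 1 - cball (0::complex) (sqrt x)) = ennreal (pi - pi * x)"
      proof (subst emeasure_Diff)
        show "cball (0::complex) (sqrt x) \<subseteq> ball 0 1"
        proof -
          have "sqrt x < sqrt 1" using 2 by (simp only: real_sqrt_less_iff)
          then show ?thesis by (auto intro: le_less_trans simp only: real_sqrt_one mem_ball_0 mem_cball_0)
        qed
      qed (use 2 in \<open>auto simp: emeasure_complex_ball emeasure_complex_cball ennreal_minus\<close>)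
      moreover have "{0..1} \<inter> {x<..} = {x<..1}" using 2 by auto
      ultimately show ?thesis unfolding M N using 2
        by (simp add: ennreal_mult[symmetric] algebra_simps)
    next
      case 3
      then have e: "{0..1} \<inter> {x<..} = {}" "ball 0 1 \<inter> {s::complex. (cmod s)\<^sup>2 > x} = {}"
        using abs_square_less_1[of "cmod _"] by (auto simp: not_less) (metis abs_norm_cancel less_le_trans not_less order.asym)
      show ?thesis unfolding M N e by simp
    qed
  qed
  show "emeasure ?M {x <..} < \<infinity>" for x
  proof -
    have "emeasure ?M {x <..} \<le> emeasure lborel (ball (0::complex) 1)"
      unfolding M by (intro emeasure_mono) auto
    also have "\<dots> < \<infinity>" by (rule emeasure_lborel_ball_finite)
    finally show ?thesis .
  qed
qed auto

lemma nn_integral_disc_radial: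
  fixes g :: "real \<Rightarrow> ennreal"
  assumes [measurable]: "g \<in> borel_measurable borel"
  shows "(\<integral>\<^sup>+s\<in>ball (0::complex) 1. g ((cmod s)\<^sup>2) \<partial>lborel) = ennreal pi * (\<integral>\<^sup>+x\<in>{0..1}. g x \<partial>lborel)"
proof -
  have "(\<integral>\<^sup>+s\<in>ball (0::complex) 1. g ((cmod s)\<^sup>2) \<partial>lborel)
      = (\<integral>\<^sup>+x. g x \<partial>distr (density lborel (indicator (ball (0::complex) 1))) borel (\<lambda>s. (cmod s)\<^sup>2))"
    by (subst nn_integral_distr, simp, simp, subst nn_integral_density) (auto simp: mult_ac)
  also have "\<dots> = (\<integral>\<^sup>+x. ennreal pi * (g x * indicator {0..1::real} x) \<partial>lborel)"
    unfolding distr_cmod_power2_disc by (subst nn_integral_density) (auto simp: mult_ac)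
  also have "\<dots> = ennreal pi * (\<integral>\<^sup>+x\<in>{0..1}. g x \<partial>lborel)"
    by (rule nn_integral_cmult) measurable
  finally show ?thesis .
qed

text \<open>Put y = 1 - x and d = 1 - b. The denominator is at least d and at least y/2; using the
  first bound for y \<le> d and the second beyond gives d^-a / (1 - a) from the integral of y^-a
  near 0, and 2 d^-a / a from the tail of 2 y^(-a-1). Convergence at the two ends is what restricts
  a to 0 < a < 1.\<close>

lemma nn_integral_powr_over_affine_le:
  fixes a b :: real
  assumes a: "0 < a" "a < 1" and b: "0 \<le> b" "b < 1"
  shows "(\<integral>\<^sup>+x\<in>{0..1}. ennreal ((1 - x) powr - a / (1 - b * x)) \<partial>lborel)
    \<le> ennreal ((1 / (1 - a) + 2 / a) * (1 - b) powr - a)"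
proof -
  define d where "d = 1 - b"
  have d: "0 < d" "d \<le> 1" using b by (auto simp: d_def)
  have "(\<integral>\<^sup>+x\<in>{0..1}. ennreal ((1 - x) powr - a / (1 - b * x)) \<partial>lborel)
      = (\<integral>\<^sup>+y. ennreal (y powr - a / (1 - b * (1 - y))) * indicator {0..1} (1 - y) \<partial>lborel)"
    by (subst nn_integral_real_affine[of _ "-1" 1]) auto
  also have "\<dots> \<le> (\<integral>\<^sup>+y. (ennreal (1 / d) * (ennreal (y powr - a) * indicator {0..d} y)
       + ennreal 2 * (ennreal (y powr (- a - 1)) * indicator {d..} y)) \<partial>lborel)"
  proof (rule nn_integral_mono)
    fix y :: real
    show "ennreal (y powr - a / (1 - b * (1 - y))) * indicator {0..1} (1 - y)
      \<le> ennreal (1 / d) * (ennreal (y powr - a) * indicator {0..d} y)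
       + ennreal 2 * (ennreal (y powr (- a - 1)) * indicator {d..} y)"
    proof (cases "0 \<le> y \<and> y \<le> 1")
      case y: True
      have 1: "1 - b * (1 - y) \<ge> d"
        using y b by (simp add: d_def algebra_simps)
      have 2: "2 * (1 - b * (1 - y)) \<ge> y"
      proof (cases "b \<le> 1/2")
        case True
        have "b * (1 - y) \<le> 1/2 * 1" using True y b by (intro mult_mono) auto
        then show ?thesis using y by simp
      next
        case False
        then have "2 * b * y \<ge> 1 * y" using y by (intro mult_right_mono) auto
        moreover have *: "2 * (1 - b * (1 - y)) = 2 * b * y + 2 * (1 - b)"
          by (simp only: algebra_simps)
        ultimately have "1 * y + 0 \<le> 2 * b * y + 2 * (1 - b)"
          using b by (intro add_mono) auto
        with * show ?thesis by simp
      qed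
      show ?thesis
      proof (cases "y \<le> d")
        case True
        have "y powr - a / (1 - b * (1 - y)) \<le> 1 / d * y powr - a"
          using 1 d by (simp add: frac_le)
        then have "ennreal (y powr - a / (1 - b * (1 - y))) \<le> ennreal (1 / d) * ennreal (y powr - a)"
          using d by (simp add: ennreal_mult[symmetric] ennreal_leI del: ennreal_le_iff)
        then show ?thesis using y True by (auto intro: order_trans simp: add_increasing2)
      next
        case False
        then have yd: "y > d" "y > 0" using d by auto
        have "y powr - a / (1 - b * (1 - y)) \<le> y powr - a / (y / 2)"
          using 2 yd by (intro divide_left_mono) (auto intro!: mult_pos_pos)
        also have "\<dots> = 2 * y powr (- a - 1)"
          using yd by (simp add: powr_diff)
        finally have "ennreal (y powr - a / (1 - b * (1 - y))) \<le> ennreal 2 * ennreal (y powr (- a - 1))"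
          by (simp add: ennreal_mult[symmetric] ennreal_leI del: ennreal_le_iff ennreal_numeral)
        then show ?thesis using y yd by auto
      qed
    qed (auto simp: indicator_def)
  qed
  also have "\<dots> = ennreal (1 / d) * (\<integral>\<^sup>+y. ennreal (y powr - a) * indicator {0..d} y \<partial>lborel)
      + ennreal 2 * (\<integral>\<^sup>+y. ennreal (y powr (- a - 1)) * indicator {d..} y \<partial>lborel)"
    by (simp add: nn_integral_add nn_integral_cmult)
  also have "(\<integral>\<^sup>+y. ennreal (y powr - a) * indicator {0..d} y \<partial>lborel) = ennreal (d powr (- a + 1) / (- a + 1))"
    using nn_integral_has_integral_lebesgue[OF _ has_integral_powr_from_0[of "- a" d]] a d
    by (simp add: mult.commute[of _ "indicator _ _"] indicator_mult_ennreal)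
  also have "(\<integral>\<^sup>+y. ennreal (y powr (- a - 1)) * indicator {d..} y \<partial>lborel)
      = ennreal (- (d powr (- a - 1 + 1)) / (- a - 1 + 1))"
    using nn_integral_has_integral_lebesgue[OF _ has_integral_powr_to_inf[of "- a - 1" d]] a d
    by (simp add: mult.commute[of _ "indicator _ _"] indicator_mult_ennreal)
  also have "ennreal (1 / d) * ennreal (d powr (- a + 1) / (- a + 1)) + ennreal 2 * ennreal (- (d powr (- a - 1 + 1)) / (- a - 1 + 1))
     = ennreal (1 / d * (d powr (- a + 1) / (- a + 1)) + 2 * (- (d powr (- a - 1 + 1)) / (- a - 1 + 1)))"
    using a d by (simp add: ennreal_mult[symmetric] ennreal_plus[symmetric] del: ennreal_plus ennreal_numeral)
  also have "1 / d * (d powr (- a + 1) / (- a + 1)) + 2 * (- (d powr (- a - 1 + 1)) / (- a - 1 + 1))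
     = (1 / (1 - a) + 2 / a) * d powr - a"
  proof -
    have "d powr (- a + 1) = d * d powr - a" using d powr_add[of d "- a" 1] by simp
    then show ?thesis using a d by (simp add: field_simps)
  qed
  finally show ?thesis by (simp add: d_def)
qed

text \<open>Forelli-Rudin estimate: averaging over rotations and passing to x = |s|^2 leave a
  one-dimensional integral with b = |v|^2. The weight reproduces itself up to a constant, as a Schur
  test function must.\<close>

lemma nn_integral_disc_kernel_powr_le:
  assumes a: "0 < a" "a < 1" and v: "cmod v < 1"
  shows "(\<integral>\<^sup>+s\<in>ball 0 1. ennreal ((1 - (cmod s)\<^sup>2) powr - a) * disc_kernel v s \<partial>lborel)
    \<le> ennreal (pi * (1 / (1 - a) + 2 / a) * (1 - (cmod v)\<^sup>2) powr - a)"
proof -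
  have v2: "(cmod v)\<^sup>2 < 1" using v by (simp add: abs_square_less_1)
  have "(\<integral>\<^sup>+s\<in>ball 0 1. ennreal ((1 - (cmod s)\<^sup>2) powr - a) * disc_kernel v s \<partial>lborel)
     = (\<integral>\<^sup>+s\<in>ball 0 1. ennreal ((1 - (cmod s)\<^sup>2) powr - a) * ennreal (1 / (1 - (cmod v)\<^sup>2 * (cmod s)\<^sup>2)) \<partial>lborel)"
    using nn_integral_disc_kernel_radial[of "\<lambda>r. ennreal ((1 - r\<^sup>2) powr - a)" v] v by simp
  also have "\<dots> = (\<integral>\<^sup>+s\<in>ball (0::complex) 1. ennreal ((1 - (cmod s)\<^sup>2) powr - a / (1 - (cmod v)\<^sup>2 * (cmod s)\<^sup>2)) \<partial>lborel)"
    by (intro nn_integral_cong) (simp add: ennreal_mult'[symmetric])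
  also have "\<dots> = ennreal pi * (\<integral>\<^sup>+x\<in>{0..1}. ennreal ((1 - x) powr - a / (1 - (cmod v)\<^sup>2 * x)) \<partial>lborel)"
    by (rule nn_integral_disc_radial) measurable
  also have "\<dots> \<le> ennreal pi * ennreal ((1 / (1 - a) + 2 / a) * (1 - (cmod v)\<^sup>2) powr - a)"
    using a v2 by (intro mult_left_mono nn_integral_powr_over_affine_le) auto
  finally show ?thesis using a by (simp add: ennreal_mult[symmetric] mult.assoc)
qed

section \<open>The positive Bergman operator on the disc\<close>

text \<open>The graph of y^4 lies above its tangent at c, that is y^4 \<ge> 4 c^3 y - 3 c^4. Take y
  = h/p and multiply by p. The difference of the two sides factors explicitly as a square times a
  sum of squares.\<close>

lemma ennreal_tangent_power4:
  fixes h :: ennreal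
  assumes p: "p > 0" and c: "c \<ge> 0"
  shows "ennreal (4 * c ^ 3) * h \<le> h ^ 4 * ennreal (1 / p ^ 3) + ennreal (3 * c ^ 4) * ennreal p"
proof (cases h)
  case (real x)
  define y where "y = x / p"
  have x: "x = y * p" using p by (simp add: y_def)
  have "0 \<le> (y - c)\<^sup>2 * ((y + c)\<^sup>2 + 2 * c\<^sup>2)" by simp
  also have "\<dots> = y ^ 4 + 3 * c ^ 4 - 4 * c ^ 3 * y"
    by (simp add: power2_eq_square power3_eq_cube power4_eq_xxxx algebra_simps)
  finally have "4 * c ^ 3 * y * p \<le> (y ^ 4 + 3 * c ^ 4) * p"
    using p by simp
  also have "\<dots> = x ^ 4 * (1 / p ^ 3) + 3 * c ^ 4 * p"
    using p by (simp add: x field_simps power3_eq_cube power4_eq_xxxx)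
  finally have "4 * c ^ 3 * x \<le> x ^ 4 * (1 / p ^ 3) + 3 * c ^ 4 * p" by (simp add: x mult.assoc)
  then show ?thesis using real p c
    by (simp add: ennreal_power ennreal_mult[symmetric] ennreal_plus[symmetric] ennreal_leI
             del: ennreal_plus ennreal_le_iff)
next
  case top
  then show ?thesis using p by (simp add: power4_eq_xxxx ennreal_top_mult)
qed

text \<open>Hoelder's inequality with exponents 4 and 4/3. Integrating the tangent inequality at \<open>c = I / B\<close>, where \<open>I\<close> is the integral of \<open>k * h\<close>, avoids real powers of extended reals.\<close>

lemma nn_integral_Hoelder4:
  fixes k h :: "'a \<Rightarrow> ennreal" and p :: "'a \<Rightarrow> real"
  assumes [measurable]: "k \<in> borel_measurable M" "h \<in> borel_measurable M" "p \<in> borel_measurable M"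
    and p: "\<And>x. x \<in> space M \<Longrightarrow> k x \<noteq> 0 \<Longrightarrow> p x > 0"
    and B: "(\<integral>\<^sup>+x. k x * ennreal (p x) \<partial>M) \<le> ennreal B" "B > 0"
  shows "(\<integral>\<^sup>+x. k x * h x \<partial>M) ^ 4 \<le> ennreal (B ^ 3) * (\<integral>\<^sup>+x. k x * h x ^ 4 * ennreal (1 / p x ^ 3) \<partial>M)"
    (is "?I ^ 4 \<le> _ * ?A")
proof -
  have key: "ennreal (4 * c ^ 3) * ?I \<le> ?A + ennreal (3 * c ^ 4 * B)" if c: "c \<ge> 0" for c
  proof -
    have "ennreal (4 * c ^ 3) * ?I = (\<integral>\<^sup>+x. k x * (ennreal (4 * c ^ 3) * h x) \<partial>M)"
      by (subst nn_integral_cmult[symmetric]) (auto simp: mult_ac)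
    also have "\<dots> \<le> (\<integral>\<^sup>+x. k x * (h x ^ 4 * ennreal (1 / p x ^ 3) + ennreal (3 * c ^ 4) * ennreal (p x)) \<partial>M)"
    proof (rule nn_integral_mono)
      fix x assume "x \<in> space M"
      then show "k x * (ennreal (4 * c ^ 3) * h x)
         \<le> k x * (h x ^ 4 * ennreal (1 / p x ^ 3) + ennreal (3 * c ^ 4) * ennreal (p x))"
        using ennreal_tangent_power4[OF p c] by (cases "k x = 0") (auto intro!: mult_left_mono)
    qed
    also have "\<dots> = (\<integral>\<^sup>+x. k x * h x ^ 4 * ennreal (1 / p x ^ 3) + ennreal (3 * c ^ 4) * (k x * ennreal (p x)) \<partial>M)"
      by (simp add: distrib_left mult_ac)
    also have "\<dots> = ?A + ennreal (3 * c ^ 4) * (\<integral>\<^sup>+x. k x * ennreal (p x) \<partial>M)"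
      by (simp add: nn_integral_add nn_integral_cmult)
    also have "\<dots> \<le> ?A + ennreal (3 * c ^ 4) * ennreal B"
      by (intro add_left_mono mult_left_mono B) auto
    finally show ?thesis using B c by (simp add: ennreal_mult)
  qed
  show ?thesis
  proof (cases "?A = \<infinity>")
    case True
    then show ?thesis using B by (simp add: ennreal_mult_top)
  next
    case A: False
    then obtain A where A: "?A = ennreal A" "A \<ge> 0" by (cases ?A) auto
    \<comment> \<open>The choice c = I / B presupposes that I is finite; the tangent inequality at c
      = 1 provides this.\<close>
    have "?I \<noteq> \<infinity>"
    proof
      assume "?I = \<infinity>"
      with key[of 1] B A show False by (simp add: ennreal_mult_top ennreal_plus[symmetric] top_unique del: ennreal_plus)
    qed
    then obtain i where i: "?I = ennreal i" "i \<ge> 0" by (cases ?I) auto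
    have "ennreal (4 * (i / B) ^ 3) * ?I \<le> ?A + ennreal (3 * (i / B) ^ 4 * B)"
      using i B by (intro key) auto
    then have "4 * (i / B) ^ 3 * i \<le> A + 3 * (i / B) ^ 4 * B"
      using i A B by (simp add: ennreal_mult[symmetric] ennreal_plus[symmetric] del: ennreal_plus)
    then have "i ^ 4 \<le> B ^ 3 * A"
      using B by (simp add: field_simps power3_eq_cube power4_eq_xxxx)
    then show ?thesis
      using i A B by (simp add: ennreal_power ennreal_mult[symmetric])
  qed
qed

section \<open>The strong L^4 bound by a Schur test\<close>

definition disc_proj :: "(complex \<Rightarrow> ennreal) \<Rightarrow> complex \<Rightarrow> ennreal" where
  "disc_proj h v = (\<integral>\<^sup>+s\<in>ball 0 1. disc_kernel v s * h s \<partial>lborel)"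

lemma measurable_disc_proj [measurable]:
  assumes [measurable]: "h \<in> borel_measurable borel"
  shows "disc_proj h \<in> borel_measurable borel"
  unfolding disc_proj_def by measurable

text \<open>Schur test with the weight \<open>(1 - |s|\<^sup>2) powr - (1/4)\<close>; its third power is still in the admissible range \<open>0 < a < 1\<close>. The constant \<open>28/3\<close> is \<open>1 / (1 - a) + 2 / a\<close> at \<open>a = 1/4\<close>, and \<open>20/3\<close> below is its value at \<open>a = 3/4\<close>.\<close>

lemma disc_proj_power4_le:
  fixes h :: "complex \<Rightarrow> ennreal"
  assumes [measurable]: "h \<in> borel_measurable borel" and v: "cmod v < 1"
  defines "w \<equiv> \<lambda>z. 1 - (cmod z)\<^sup>2"
  shows "disc_proj h v ^ 4 \<le> ennreal ((pi * (28/3)) ^ 3 * w v powr - (3/4)) *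
           (\<integral>\<^sup>+s\<in>ball 0 1. disc_kernel v s * h s ^ 4 * ennreal (w s powr (3/4)) \<partial>lborel)"
proof -
  define k where "k s = disc_kernel v s * indicator (ball 0 1) s" for s
  have [measurable]: "k \<in> borel_measurable borel" "w \<in> borel_measurable borel"
    unfolding k_def w_def by measurable
  have wpos: "w z > 0" if "cmod z < 1" for z
    using that by (simp add: w_def abs_square_less_1)
  have "(\<integral>\<^sup>+s. k s * ennreal (w s powr - (1/4)) \<partial>lborel) \<le> ennreal (pi * (28/3) * w v powr - (1/4))"
    using nn_integral_disc_kernel_powr_le[of "1/4" v] v by (simp add: k_def w_def mult_ac)
  then have "(\<integral>\<^sup>+s. k s * h s \<partial>lborel) ^ 4 \<le> ennreal ((pi * (28/3) * w v powr - (1/4)) ^ 3) *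
       (\<integral>\<^sup>+s. k s * h s ^ 4 * ennreal (1 / (w s powr - (1/4)) ^ 3) \<partial>lborel)"
    using wpos[OF v] by (intro nn_integral_Hoelder4) (auto simp: k_def indicator_def dest!: wpos split: if_splits)
  also have "(pi * (28/3) * w v powr - (1/4)) ^ 3 = (pi * (28/3)) ^ 3 * w v powr - (3/4)"
  proof -
    have "(w v powr - (1/4)) ^ 3 = w v powr - (3/4)"
      using wpos[OF v] by (simp add: powr_power)
    then show ?thesis by (simp only: power_mult_distrib)
  qed
  also have "(\<integral>\<^sup>+s. k s * h s ^ 4 * ennreal (1 / (w s powr - (1/4)) ^ 3) \<partial>lborel)
     = (\<integral>\<^sup>+s\<in>ball 0 1. disc_kernel v s * h s ^ 4 * ennreal (w s powr (3/4)) \<partial>lborel)"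
  proof (intro nn_integral_cong)
    fix s
    have "1 / (w s powr - (1/4)) ^ 3 = w s powr (3/4)" if "cmod s < 1"
      using wpos[OF that] by (simp add: powr_power powr_minus divide_simps)
    then show "k s * h s ^ 4 * ennreal (1 / (w s powr - (1/4)) ^ 3)
      = disc_kernel v s * h s ^ 4 * ennreal (w s powr (3/4)) * indicator (ball 0 1) s"
      by (auto simp: k_def indicator_def)
  qed
  finally show ?thesis by (simp add: disc_proj_def k_def mult_ac)
qed

text \<open>Second half of the Schur test: integrate the pointwise bound over v, exchange the
  integrals, and use the symmetry of the kernel to apply the Forelli-Rudin estimate in v with a =
  3/4. The resulting power of \<open>w s\<close> cancels the one left by Hoelder's
  inequality.\<close>

lemma disc_proj_bounded_L4:
  "\<exists>C>0. \<forall>h \<in> borel_measurable borel.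
     (\<integral>\<^sup>+v\<in>ball 0 1. disc_proj h v ^ 4 \<partial>lborel) \<le> ennreal C * (\<integral>\<^sup>+s\<in>ball 0 1. h s ^ 4 \<partial>lborel)"
proof (intro exI[of _ "(pi * (28/3)) ^ 3 * (pi * (20/3))"] conjI ballI)
  fix h :: "complex \<Rightarrow> ennreal" assume [measurable]: "h \<in> borel_measurable borel"
  define w :: "complex \<Rightarrow> real" where "w = (\<lambda>z. 1 - (cmod z)\<^sup>2)"
  have [measurable]: "w \<in> borel_measurable borel"
    unfolding w_def by measurable
  have wpos: "w z > 0" if "cmod z < 1" for z
    using that by (simp add: w_def abs_square_less_1)
  define c where "c = (pi * (28/3)) ^ 3"
  have c: "c \<ge> 0" by (simp add: c_def)
  let ?D = "ball (0::complex) 1"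
  have "(\<integral>\<^sup>+v\<in>?D. disc_proj h v ^ 4 \<partial>lborel)
    \<le> (\<integral>\<^sup>+v. (\<integral>\<^sup>+s. ennreal c * ennreal (w v powr - (3/4)) * disc_kernel v s * h s ^ 4 * ennreal (w s powr (3/4)) *
         indicator ?D s * indicator ?D v \<partial>lborel) \<partial>lborel)"
  proof (rule nn_integral_mono)
    fix v
    show "disc_proj h v ^ 4 * indicator ?D v \<le> (\<integral>\<^sup>+s. ennreal c * ennreal (w v powr - (3/4)) * disc_kernel v s * h s ^ 4 * ennreal (w s powr (3/4)) *
         indicator ?D s * indicator ?D v \<partial>lborel)"
    proof (cases "cmod v < 1")
      case True
      have "(\<integral>\<^sup>+s. ennreal c * ennreal (w v powr - (3/4)) * disc_kernel v s * h s ^ 4 * ennreal (w s powr (3/4)) *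
         indicator ?D s * indicator ?D v \<partial>lborel)
        = (\<integral>\<^sup>+s. (ennreal c * ennreal (w v powr - (3/4))) * (disc_kernel v s * h s ^ 4 * ennreal (w s powr (3/4)) *
         indicator ?D s) \<partial>lborel)"
        using True by (simp add: mult_ac)
      also have "\<dots> = ennreal c * ennreal (w v powr - (3/4)) * (\<integral>\<^sup>+s\<in>?D. disc_kernel v s * h s ^ 4 * ennreal (w s powr (3/4)) \<partial>lborel)"
        by (rule nn_integral_cmult) measurable
      finally show ?thesis
        using disc_proj_power4_le[of h v] True c by (simp add: w_def c_def ennreal_mult)
    qed simp
  qed
  also have "\<dots> = (\<integral>\<^sup>+s. (\<integral>\<^sup>+v. ennreal c * ennreal (w v powr - (3/4)) * disc_kernel v s * h s ^ 4 * ennreal (w s powr (3/4)) *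
         indicator ?D s * indicator ?D v \<partial>lborel) \<partial>lborel)"
    by (rule lborel_pair.Fubini') measurable
  also have "\<dots> \<le> (\<integral>\<^sup>+s. ennreal (c * (pi * (20/3))) * (h s ^ 4 * indicator ?D s) \<partial>lborel)"
  proof (rule nn_integral_mono)
    fix s
    show "(\<integral>\<^sup>+v. ennreal c * ennreal (w v powr - (3/4)) * disc_kernel v s * h s ^ 4 * ennreal (w s powr (3/4)) *
         indicator ?D s * indicator ?D v \<partial>lborel) \<le> ennreal (c * (pi * (20/3))) * (h s ^ 4 * indicator ?D s)"
    proof (cases "cmod s < 1")
      case True
      have "(\<integral>\<^sup>+v. ennreal c * ennreal (w v powr - (3/4)) * disc_kernel v s * h s ^ 4 * ennreal (w s powr (3/4)) *
         indicator ?D s * indicator ?D v \<partial>lborel)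
        = (\<integral>\<^sup>+v. ennreal c * h s ^ 4 * ennreal (w s powr (3/4)) * (ennreal (w v powr - (3/4)) * disc_kernel s v * indicator ?D v) \<partial>lborel)"
        using True by (simp add: mult_ac disc_kernel_commute)
      also have "\<dots> = ennreal c * h s ^ 4 * ennreal (w s powr (3/4)) * (\<integral>\<^sup>+v\<in>?D. ennreal (w v powr - (3/4)) * disc_kernel s v \<partial>lborel)"
        by (rule nn_integral_cmult) measurable
      also have "\<dots> \<le> ennreal c * h s ^ 4 * ennreal (w s powr (3/4)) * ennreal (pi * (20/3) * w s powr - (3/4))"
        using nn_integral_disc_kernel_powr_le[of "3/4" s] True by (intro mult_left_mono) (auto simp: w_def)
      also have "\<dots> = h s ^ 4 * (ennreal c * (ennreal (w s powr (3/4)) * ennreal (pi * (20/3) * w s powr - (3/4))))"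
        by (simp only: mult_ac)
      also have "\<dots> = h s ^ 4 * ennreal (c * (w s powr (3/4) * (pi * (20/3) * w s powr - (3/4))))"
        by (simp only: ennreal_mult'[OF c] ennreal_mult'[OF powr_ge_zero])
      also have "w s powr (3/4) * (pi * (20/3) * w s powr - (3/4)) = pi * (20/3)"
        using wpos[OF True] by (simp add: powr_minus)
      finally show ?thesis using True by (simp add: mult_ac)
    qed simp
  qed
  also have "\<dots> = ennreal (c * (pi * (20/3))) * (\<integral>\<^sup>+s\<in>?D. h s ^ 4 \<partial>lborel)"
    by (rule nn_integral_cmult) measurable
  finally show "(\<integral>\<^sup>+v\<in>?D. disc_proj h v ^ 4 \<partial>lborel)
     \<le> ennreal ((pi * (28/3)) ^ 3 * (pi * (20/3))) * (\<integral>\<^sup>+s\<in>?D. h s ^ 4 \<partial>lborel)"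
    by (simp add: c_def)
qed simp

section \<open>The weak bound in the presence of the factor 1/|v|\<close>

text \<open>For |v| \<le> 1/2 and |s| < 1 the number 1 - v * cnj s has modulus at least 1/2, so the
  kernel is at most 4. Near the origin the operator is thus controlled by a single number, the L^1
  norm.\<close>

lemma disc_proj_le_near_0:
  assumes [measurable]: "h \<in> borel_measurable borel" and v: "cmod v \<le> 1/2"
  shows "disc_proj h v \<le> 4 * (\<integral>\<^sup>+s\<in>ball 0 1. h s \<partial>lborel)"
proof -
  have "disc_proj h v \<le> (\<integral>\<^sup>+s. 4 * (h s * indicator (ball 0 1) s) \<partial>lborel)"
    unfolding disc_proj_def
  proof (rule nn_integral_mono)
    fix s
    show "disc_kernel v s * h s * indicator (ball 0 1) s \<le> 4 * (h s * indicator (ball 0 1) s)"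
    proof (cases "cmod s < 1")
      case True
      have "cmod (v * cnj s) \<le> 1/2 * 1"
        unfolding norm_mult using v True by (intro mult_mono) auto
      then have "1/2 \<le> cmod (1 - v * cnj s)"
        using norm_triangle_ineq2[of 1 "v * cnj s"] by simp
      then have "(1/2)\<^sup>2 \<le> (cmod (1 - v * cnj s))\<^sup>2" by (intro power_mono) auto
      then have "1 / (cmod (1 - v * cnj s))\<^sup>2 \<le> 1 / (1/2)\<^sup>2"
        by (intro divide_left_mono) (auto simp: power2_eq_square intro!: mult_pos_pos)
      then have "disc_kernel v s \<le> ennreal 4"
        unfolding disc_kernel_def by (intro ennreal_leI) (simp add: power2_eq_square)
      then show ?thesis using True by (simp add: mult_right_mono)
    qed simp
  qed
  also have "\<dots> = 4 * (\<integral>\<^sup>+s\<in>ball 0 1. h s \<partial>lborel)"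
    by (rule nn_integral_cmult) measurable
  finally show ?thesis .
qed

text \<open>The weight is at least 1 on the punctured disc. It is 0 at the origin by the convention
  1/0 = 0, hence the comparison almost everywhere.\<close>

lemma nn_integral_disc_le_weighted:
  fixes g :: "complex \<Rightarrow> ennreal"
  shows "(\<integral>\<^sup>+s\<in>ball 0 1. g s \<partial>lborel) \<le> (\<integral>\<^sup>+s\<in>ball 0 1. g s * ennreal (1 / (cmod s)\<^sup>2) \<partial>lborel)"
proof (rule nn_integral_mono_AE)
  have "AE s in lborel. s \<noteq> (0::complex)" by (rule AE_lborel_singleton)
  then show "AE s in lborel. g s * indicator (ball 0 1) s \<le> g s * ennreal (1 / (cmod s)\<^sup>2) * indicator (ball 0 1) s"
  proof eventually_elim
    case (elim s)
    show ?case
    proof (cases "cmod s < 1")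
      case True
      then have "(cmod s)\<^sup>2 \<le> 1" by (simp add: abs_square_le_1)
      then have "ennreal 1 \<le> ennreal (1 / (cmod s)\<^sup>2)" using elim by (intro ennreal_leI) simp
      then have "g s * 1 \<le> g s * ennreal (1 / (cmod s)\<^sup>2)" by (intro mult_left_mono) simp_all
      then show ?thesis using True by simp
    qed simp
  qed
qed

text \<open>For \<open>|v| \<le> 1/2\<close> the operator is bounded by a constant multiple of \<open>1 / |v|\<close>, whose level sets have \<open>|v|\<^sup>2\<close>-measure of order \<open>t powr - 4\<close>; this endpoint is what makes 4 the critical exponent. For \<open>|v| > 1/2\<close> the singular factor is harmless and Chebyshev's inequality applies.\<close>

lemma disc_proj_level_integral_le:
  assumes [measurable]: "h \<in> borel_measurable borel" and t: "t > 0"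
    and C: "(\<integral>\<^sup>+v\<in>ball 0 1. disc_proj h v ^ 4 \<partial>lborel) \<le> ennreal C * (\<integral>\<^sup>+s\<in>ball 0 1. h s ^ 4 \<partial>lborel)" "C > 0"
  shows "(\<integral>\<^sup>+v\<in>ball 0 1. ennreal ((cmod v)\<^sup>2) *
      indicator {v. ennreal t < ennreal (1 / cmod v) * disc_proj h v} v \<partial>lborel)
    \<le> ennreal ((256 * pi ^ 4 + 16 * C) / t ^ 4) * (\<integral>\<^sup>+s\<in>ball 0 1. h s ^ 4 * ennreal (1 / (cmod s)\<^sup>2) \<partial>lborel)"
    (is "?L \<le> _ * ?A")
proof (cases "?A = \<infinity>")
  case True
  \<comment> \<open>Since 0 * \<infinity> = 0 in \<open>ennreal\<close>, an infinite weighted norm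
    settles the claim only once the coefficient is known to be positive.\<close>
  have "(256 * pi ^ 4 + 16 * C) / t ^ 4 \<noteq> 0" using t C(2) by (simp add: add_pos_pos less_imp_neq[symmetric])
  then have "ennreal ((256 * pi ^ 4 + 16 * C) / t ^ 4) * \<infinity> = \<infinity>"
    using t C(2) by (subst infinity_ennreal_def, subst ennreal_mult_top) auto
  then show ?thesis unfolding True by simp
next
  case False
  let ?D = "ball (0::complex) 1"
  let ?B = "\<integral>\<^sup>+s\<in>?D. h s ^ 4 \<partial>lborel"
  let ?I = "\<integral>\<^sup>+s\<in>?D. h s \<partial>lborel"
  have BA: "?B \<le> ?A" by (rule nn_integral_disc_le_weighted)
  then obtain b where b: "?B = ennreal b" "b \<ge> 0" using False by (cases ?B) (auto simp: top_unique)
  \<comment> \<open>Hoelder's inequality with constant weight 1 on the disc, whose area \<pi> serves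
    as \<open>B\<close>.\<close>
  have "(\<integral>\<^sup>+s. indicator ?D s * h s \<partial>lborel) ^ 4
     \<le> ennreal (pi ^ 3) * (\<integral>\<^sup>+s. indicator ?D s * h s ^ 4 * ennreal (1 / 1 ^ 3) \<partial>lborel)"
    by (rule nn_integral_Hoelder4) (auto simp: emeasure_complex_ball)
  then have I4: "?I ^ 4 \<le> ennreal (pi ^ 3 * b)"
    by (simp add: mult.commute[of "indicator _ _"] b ennreal_mult)
  then have "?I \<noteq> \<infinity>" by (auto simp: power4_eq_xxxx top_unique)
  then obtain i where i: "?I = ennreal i" "i \<ge> 0" by (cases ?I) auto
  have ib: "i ^ 4 \<le> pi ^ 3 * b" using I4 i b by (simp add: ennreal_power)
  \<comment> \<open>For |v| \<le> 1/2 the level condition gives t < 4 i / |v|, that is |v| < R.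
    There the weight is at most R^2 on an area \<pi> R^2, whence the power t^-4.\<close>
  define R where "R = 4 * i / t"
  have R: "R \<ge> 0" using i t by (simp add: R_def)
  have "?L \<le> (\<integral>\<^sup>+v. ennreal (R\<^sup>2) * indicator (ball 0 R) v
       + ennreal (16 / t ^ 4) * (disc_proj h v ^ 4 * indicator ?D v) \<partial>lborel)"
  proof (rule nn_integral_mono)
    fix v
    show "ennreal ((cmod v)\<^sup>2) * indicator {v. ennreal t < ennreal (1 / cmod v) * disc_proj h v} v * indicator ?D v
      \<le> ennreal (R\<^sup>2) * indicator (ball 0 R) v + ennreal (16 / t ^ 4) * (disc_proj h v ^ 4 * indicator ?D v)"
    proof (cases "ennreal t < ennreal (1 / cmod v) * disc_proj h v \<and> cmod v < 1")
      case True
      then have lt: "ennreal t < ennreal (1 / cmod v) * disc_proj h v" and v1: "cmod v < 1" by auto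
      \<comment> \<open>At v = 0 the convention 1/0 = 0 makes the level condition false.\<close>
      have v0: "v \<noteq> 0" using lt by auto
      show ?thesis
      proof (cases "cmod v \<le> 1/2")
        case small: True
        have "ennreal t < ennreal (1 / cmod v) * (4 * ?I)"
          by (rule less_le_trans[OF lt mult_left_mono[OF disc_proj_le_near_0[OF _ small]]]) simp_all
        also have "\<dots> = ennreal (1 / cmod v * (4 * i))"
          using i by (subst ennreal_mult) (auto simp: ennreal_mult)
        finally have "t < 1 / cmod v * (4 * i)" using t by (simp add: ennreal_less_iff)
        then have "cmod v < R" using v0 t by (simp add: R_def field_simps)
        then show ?thesis using True
          by (auto intro!: add_increasing2 power_mono ennreal_leI)
      next
        case False
        \<comment> \<open>Here 1/|v| \<le> 2, so Chebyshev's inequality contributes 2^4 /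
          t^4.\<close>
        have "1 / cmod v \<le> 1 / (1 / 2)" using False by (intro divide_left_mono) auto
        then have "1 / cmod v \<le> 2" by simp
        then have "ennreal (1 / cmod v) * disc_proj h v \<le> ennreal 2 * disc_proj h v"
          by (intro mult_right_mono ennreal_leI) auto
        with lt have "ennreal t \<le> ennreal 2 * disc_proj h v" by simp
        then have "ennreal t ^ 4 \<le> (ennreal 2 * disc_proj h v) ^ 4" by (intro power_mono) auto
        then have "ennreal (1 / t ^ 4) * ennreal t ^ 4 \<le> ennreal (1 / t ^ 4) * (ennreal 2 * disc_proj h v) ^ 4"
          by (intro mult_left_mono) auto
        also have "ennreal (1 / t ^ 4) * ennreal t ^ 4 = 1"
          using t by (simp add: ennreal_power ennreal_mult[symmetric])
        also have "ennreal (1 / t ^ 4) * (ennreal 2 * disc_proj h v) ^ 4 = ennreal (1 / t ^ 4 * 2 ^ 4) * disc_proj h v ^ 4"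
          using t by (subst ennreal_mult) (auto simp: power_mult_distrib ennreal_power[symmetric] mult_ac)
        finally have "1 \<le> ennreal (16 / t ^ 4) * disc_proj h v ^ 4" by simp
        moreover have "ennreal ((cmod v)\<^sup>2) \<le> 1"
          using v1 by (simp add: abs_square_le_1)
        ultimately have "ennreal ((cmod v)\<^sup>2) \<le> ennreal (16 / t ^ 4) * disc_proj h v ^ 4"
          by (rule order_trans[rotated])
        then show ?thesis using True by (simp add: add_increasing)
      qed
    qed auto
  qed
  also have "\<dots> = ennreal (R\<^sup>2) * emeasure lborel (ball (0::complex) R)
     + ennreal (16 / t ^ 4) * (\<integral>\<^sup>+v\<in>?D. disc_proj h v ^ 4 \<partial>lborel)"
    by (subst nn_integral_add) (auto simp: nn_integral_cmult)
  also have "\<dots> \<le> ennreal (R\<^sup>2) * ennreal (pi * R\<^sup>2) + ennreal (16 / t ^ 4) * (ennreal C * ennreal b)"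
    using C R b by (intro add_mono mult_left_mono) (auto simp: emeasure_complex_ball)
  also have "\<dots> = ennreal (R\<^sup>2 * (pi * R\<^sup>2) + 16 / t ^ 4 * (C * b))"
  proof -
    have "0 \<le> 16 / t ^ 4" using t by simp
    then show ?thesis
      by (simp only: ennreal_mult'[symmetric] ennreal_plus[symmetric] zero_le_power2 less_imp_le[OF C(2)] b(2)
          mult_nonneg_nonneg pi_ge_zero)
  qed
  also have "\<dots> \<le> ennreal ((256 * pi ^ 4 + 16 * C) / t ^ 4 * b)"
  proof (rule ennreal_leI)
    \<comment> \<open>The 256 is 4^4 from the definition of \<open>R\<close>; \<pi> from the area of
      the small disc and \<pi>^3 from Hoelder's inequality combine to \<pi>^4.\<close>
    have "R\<^sup>2 * (pi * R\<^sup>2) = 256 * pi * i ^ 4 / t ^ 4"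
      by (simp add: R_def power2_eq_square power4_eq_xxxx mult_ac)
    also have "\<dots> \<le> 256 * pi * (pi ^ 3 * b) / t ^ 4"
      using ib t by (intro divide_right_mono mult_left_mono) auto
    finally show "R\<^sup>2 * (pi * R\<^sup>2) + 16 / t ^ 4 * (C * b) \<le> (256 * pi ^ 4 + 16 * C) / t ^ 4 * b"
      by (simp add: add_divide_distrib distrib_right power3_eq_cube power4_eq_xxxx mult.assoc)
  qed
  also have "\<dots> = ennreal ((256 * pi ^ 4 + 16 * C) / t ^ 4) * ?B"
    unfolding b(1) by (rule ennreal_mult''[OF b(2)])
  also have "\<dots> \<le> ennreal ((256 * pi ^ 4 + 16 * C) / t ^ 4) * ?A"
    by (intro mult_left_mono BA) simp
  finally show ?thesis .
qed

section \<open>The Hartogs triangle\<close>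

lemma nn_integral_mult_indicator_const:
  "(\<integral>\<^sup>+x. f x * indicator A y \<partial>M) = (\<integral>\<^sup>+x. f x \<partial>M) * indicator A y"
  by (cases "y \<in> A") simp_all

lemma sets_borel_hartogs [measurable]: "hartogs \<in> sets borel"
proof -
  have "hartogs = {z \<in> space (borel \<Otimes>\<^sub>M borel). cmod (fst z) < cmod (snd z) \<and> cmod (snd z) < 1}"
    by (auto simp: hartogs_def space_pair_measure)
  also have "\<dots> \<in> sets (borel \<Otimes>\<^sub>M borel)" by measurable
  finally show ?thesis by (simp only: borel_prod)
qed

text \<open>For 0 < |v| < 1 the slice {z : |z| < |v|} is the image of the unit disc under
  multiplication by v, with Jacobian |v|^2. For v = 0 the slice is empty and the Jacobian vanishes,
  so both sides agree there too.\<close>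

lemma nn_integral_hartogs:
  fixes F :: "complex \<times> complex \<Rightarrow> ennreal"
  assumes [measurable]: "F \<in> borel_measurable borel"
  shows "(\<integral>\<^sup>+z\<in>hartogs. F z \<partial>lborel)
    = (\<integral>\<^sup>+v\<in>ball 0 1. \<integral>\<^sup>+u\<in>ball 0 1. ennreal ((cmod v)\<^sup>2) * F (u * v, v) \<partial>lborel \<partial>lborel)"
proof -
  have "(\<integral>\<^sup>+z\<in>hartogs. F z \<partial>lborel) = (\<integral>\<^sup>+z. F z * indicator hartogs z \<partial>(lborel \<Otimes>\<^sub>M lborel))"
    by (simp add: lborel_prod)
  also have "\<dots> = (\<integral>\<^sup>+v. \<integral>\<^sup>+z. F (z, v) * indicator hartogs (z, v) \<partial>lborel \<partial>lborel)"
    by (subst lborel_pair.nn_integral_snd[symmetric]) (simp_all add: borel_prod lborel_prod)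
  also have "\<dots> = (\<integral>\<^sup>+v\<in>ball 0 1. \<integral>\<^sup>+u\<in>ball 0 1. ennreal ((cmod v)\<^sup>2) * F (u * v, v) \<partial>lborel \<partial>lborel)"
  proof (rule nn_integral_cong)
    fix v :: complex
    show "(\<integral>\<^sup>+z. F (z, v) * indicator hartogs (z, v) \<partial>lborel)
      = (\<integral>\<^sup>+u\<in>ball 0 1. ennreal ((cmod v)\<^sup>2) * F (u * v, v) \<partial>lborel) * indicator (ball 0 1) v"
    proof (cases "v = 0")
      case True
      then show ?thesis by (simp add: hartogs_def)
    next
      case False
      have "(\<integral>\<^sup>+z. F (z, v) * indicator hartogs (z, v) \<partial>lborel)
         = ennreal ((cmod v)\<^sup>2) * (\<integral>\<^sup>+u. F (v * u, v) * indicator hartogs (v * u, v) \<partial>lborel)"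
        by (rule nn_integral_complex_mult[where f = "\<lambda>z. F (z, v) * indicator hartogs (z, v)"]) (use False in measurable)
      also have "\<dots> = (\<integral>\<^sup>+u. ennreal ((cmod v)\<^sup>2) * (F (v * u, v) * indicator hartogs (v * u, v)) \<partial>lborel)"
        by (rule nn_integral_cmult[symmetric]) measurable
      also have "\<dots> = (\<integral>\<^sup>+u. ennreal ((cmod v)\<^sup>2) * F (u * v, v) * indicator (ball 0 1) u * indicator (ball 0 1) v \<partial>lborel)"
        using False by (intro nn_integral_cong) (auto simp: hartogs_def indicator_def norm_mult mult.commute)
      also have "\<dots> = (\<integral>\<^sup>+u\<in>ball 0 1. ennreal ((cmod v)\<^sup>2) * F (u * v, v) \<partial>lborel) * indicator (ball 0 1) v"
        by (rule nn_integral_multc) measurable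
      finally show ?thesis .
    qed
  qed
  finally show ?thesis .
qed

section \<open>The kernel in product coordinates and the positive operator\<close>

lemma measurable_bergman_kernel_H [measurable (raw)]:
  assumes "f \<in> borel_measurable M" "g \<in> borel_measurable M"
  shows "(\<lambda>x. bergman_kernel_H (f x) (g x)) \<in> borel_measurable M"
proof -
  have [measurable]: "f \<in> M \<rightarrow>\<^sub>M borel \<Otimes>\<^sub>M borel" "g \<in> M \<rightarrow>\<^sub>M borel \<Otimes>\<^sub>M borel"
    using assms by (simp_all add: borel_prod)
  show ?thesis unfolding bergman_kernel_H_def Let_def split_beta by measurable
qed

text \<open>At \<open>v = 0\<close> and \<open>s = 0\<close> both sides vanish because of \<open>1 / 0 = 0\<close>.\<close>

lemma bergman_kernel_H_le:
  "ennreal ((cmod s)\<^sup>2) * ennreal (cmod (bergman_kernel_H (u * v, v) (x * s, s)))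
    \<le> ennreal (1 / cmod v) * (ennreal (cmod s) * (disc_kernel u x * disc_kernel v s))"
proof (cases "v = 0 \<or> s = 0")
  case True
  then show ?thesis by (auto simp: bergman_kernel_H_def)
next
  case False
  then have "u * v * cnj (x * s) / (v * cnj s) = u * cnj x" by (simp add: field_simps)
  then have "(cmod s)\<^sup>2 * cmod (bergman_kernel_H (u * v, v) (x * s, s))
     = (1 / pi\<^sup>2) * (1 / cmod v * (cmod s * (1 / (cmod (1 - u * cnj x))\<^sup>2 * (1 / (cmod (1 - v * cnj s))\<^sup>2))))"
    using False unfolding bergman_kernel_H_def Let_def split
    by (simp add: norm_mult norm_divide norm_power power2_eq_square)
  \<comment> \<open>The normalising factor 1/\<pi>^2 is at most 1 and is dropped.\<close>
  also have "\<dots> \<le> 1 * (1 / cmod v * (cmod s * (1 / (cmod (1 - u * cnj x))\<^sup>2 * (1 / (cmod (1 - v * cnj s))\<^sup>2))))"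
    using pi_ge_two by (intro mult_right_mono) (auto intro: one_le_power)
  finally show ?thesis
    by (simp only: disc_kernel_def ennreal_mult'[symmetric] norm_ge_zero zero_le_power divide_nonneg_nonneg
        zero_le_one mult_1 ennreal_leI)
qed

text \<open>The positive majorant of the Bergman projection. Its value may be infinite, so questions
  of convergence do not arise.\<close>

definition hartogs_proj :: "(complex \<times> complex \<Rightarrow> ennreal) \<Rightarrow> complex \<times> complex \<Rightarrow> ennreal" where
  "hartogs_proj F z = (\<integral>\<^sup>+w\<in>hartogs. ennreal (cmod (bergman_kernel_H z w)) * F w \<partial>lborel)"

lemma measurable_hartogs_proj [measurable]:
  assumes [measurable]: "F \<in> borel_measurable borel"
  shows "hartogs_proj F \<in> borel_measurable borel"
  unfolding hartogs_proj_def by measurable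

text \<open>The kernel bound separates the variables: the inner integral over x is the disc operator
  in u, the outer one over s is the disc operator in v. The factor |s| joins the function in s,
  while 1/|v| comes out of both integrals.\<close>

lemma hartogs_proj_le:
  assumes [measurable]: "F \<in> borel_measurable borel"
  shows "hartogs_proj F (u * v, v)
    \<le> ennreal (1 / cmod v) * disc_proj (\<lambda>s. ennreal (cmod s) * disc_proj (\<lambda>x. F (x * s, s)) u) v"
proof -
  let ?D = "ball (0::complex) 1"
  have "hartogs_proj F (u * v, v) = (\<integral>\<^sup>+s\<in>?D. \<integral>\<^sup>+x\<in>?D. ennreal ((cmod s)\<^sup>2) *
      (ennreal (cmod (bergman_kernel_H (u * v, v) (x * s, s))) * F (x * s, s)) \<partial>lborel \<partial>lborel)"
    unfolding hartogs_proj_def by (rule nn_integral_hartogs) measurable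
  also have "\<dots> \<le> (\<integral>\<^sup>+s\<in>?D. \<integral>\<^sup>+x\<in>?D. (ennreal (1 / cmod v) * (ennreal (cmod s) * (disc_kernel u x * disc_kernel v s)))
      * F (x * s, s) \<partial>lborel \<partial>lborel)"
    unfolding mult.assoc[symmetric, of "ennreal ((cmod _)\<^sup>2)"]
    by (intro nn_integral_mono mult_right_mono bergman_kernel_H_le) auto
  also have "\<dots> = (\<integral>\<^sup>+s. \<integral>\<^sup>+x. (ennreal (1 / cmod v) * (disc_kernel v s * ennreal (cmod s) * indicator ?D s)) *
      (disc_kernel u x * F (x * s, s) * indicator ?D x) \<partial>lborel \<partial>lborel)"
    unfolding nn_integral_mult_indicator_const[symmetric]
    by (intro nn_integral_cong) (simp only: mult_ac)
  also have "\<dots> = (\<integral>\<^sup>+s. (ennreal (1 / cmod v) * (disc_kernel v s * ennreal (cmod s) * indicator ?D s)) *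
      disc_proj (\<lambda>x. F (x * s, s)) u \<partial>lborel)"
    unfolding disc_proj_def by (intro nn_integral_cong nn_integral_cmult) measurable
  also have "\<dots> = (\<integral>\<^sup>+s. ennreal (1 / cmod v) * (disc_kernel v s * (ennreal (cmod s) *
      disc_proj (\<lambda>x. F (x * s, s)) u) * indicator ?D s) \<partial>lborel)"
    by (simp add: mult_ac)
  also have "\<dots> = ennreal (1 / cmod v) * disc_proj (\<lambda>s. ennreal (cmod s) * disc_proj (\<lambda>x. F (x * s, s)) u) v"
    unfolding disc_proj_def by (rule nn_integral_cmult) measurable
  finally show ?thesis .
qed

lemma hartogs_proj_weak_type:
  "\<exists>C>0. \<forall>F \<in> borel_measurable borel. \<forall>t>0.
     emeasure lborel {z \<in> hartogs. ennreal t < hartogs_proj F z}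
       \<le> ennreal (C / t ^ 4) * (\<integral>\<^sup>+z\<in>hartogs. F z ^ 4 \<partial>lborel)"
proof -
  obtain C where C: "C > 0" "\<And>h. h \<in> borel_measurable borel \<Longrightarrow>
     (\<integral>\<^sup>+v\<in>ball 0 1. disc_proj h v ^ 4 \<partial>lborel) \<le> ennreal C * (\<integral>\<^sup>+s\<in>ball 0 1. h s ^ 4 \<partial>lborel)"
    using disc_proj_bounded_L4 by blast
  define C' where "C' = 256 * pi ^ 4 + 16 * C"
  have C': "C' > 0" using C by (auto simp: C'_def intro!: add_pos_pos)
  show ?thesis
  proof (intro exI[of _ "C' * C"] conjI ballI allI impI)
    show "C' * C > 0" using C C' by simp
    fix F :: "complex \<times> complex \<Rightarrow> ennreal" and t :: real
    assume [measurable]: "F \<in> borel_measurable borel" and t: "t > 0"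
    let ?D = "ball (0::complex) 1"
    define P where "P u s = disc_proj (\<lambda>x. F (x * s, s)) u" for u s
    define G where "G u s = ennreal (cmod s) * P u s" for u s
    have [measurable]: "case_prod P \<in> borel_measurable (borel \<Otimes>\<^sub>M borel)"
      unfolding P_def disc_proj_def by measurable
    have [measurable]: "case_prod G \<in> borel_measurable (borel \<Otimes>\<^sub>M borel)"
      unfolding G_def by measurable
    have G_borel: "G u \<in> borel_measurable borel" for u
      unfolding G_def P_def disc_proj_def by measurable
    have [measurable]: "(\<lambda>(u, v). disc_proj (G u) v) \<in> borel_measurable (borel \<Otimes>\<^sub>M borel)"
      unfolding disc_proj_def by measurable
    have "emeasure lborel {z \<in> hartogs. ennreal t < hartogs_proj F z}
      = (\<integral>\<^sup>+z. indicator {z \<in> hartogs. ennreal t < hartogs_proj F z} z \<partial>lborel)"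
      by simp
    also have "\<dots> = (\<integral>\<^sup>+z\<in>hartogs. indicator {z. ennreal t < hartogs_proj F z} z \<partial>lborel)"
      by (intro nn_integral_cong) (auto simp: indicator_def)
    also have "\<dots> = (\<integral>\<^sup>+v\<in>?D. \<integral>\<^sup>+u\<in>?D. ennreal ((cmod v)\<^sup>2) *
        indicator {z. ennreal t < hartogs_proj F z} (u * v, v) \<partial>lborel \<partial>lborel)"
      by (rule nn_integral_hartogs) measurable
    \<comment> \<open>The majorant enlarges the level set. In it u is a mere parameter of the
      function \<open>G u\<close>, so for each u this is a level set in v alone.\<close>
    also have "\<dots> \<le> (\<integral>\<^sup>+v\<in>?D. \<integral>\<^sup>+u\<in>?D. ennreal ((cmod v)\<^sup>2) *
        indicator {v. ennreal t < ennreal (1 / cmod v) * disc_proj (G u) v} v \<partial>lborel \<partial>lborel)"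
      using hartogs_proj_le[of F] unfolding G_def P_def
      by (intro nn_integral_mono mult_right_mono mult_left_mono)
         (auto simp: indicator_def intro: less_le_trans)
    also have "\<dots> = (\<integral>\<^sup>+v. \<integral>\<^sup>+u. ennreal ((cmod v)\<^sup>2) *
        indicator {v. ennreal t < ennreal (1 / cmod v) * disc_proj (G u) v} v * indicator ?D u * indicator ?D v \<partial>lborel \<partial>lborel)"
      by (simp only: nn_integral_mult_indicator_const)
    also have "\<dots> = (\<integral>\<^sup>+u. \<integral>\<^sup>+v. ennreal ((cmod v)\<^sup>2) *
        indicator {v. ennreal t < ennreal (1 / cmod v) * disc_proj (G u) v} v * indicator ?D u * indicator ?D v \<partial>lborel \<partial>lborel)"
      by (rule lborel_pair.Fubini') measurable
    also have "\<dots> = (\<integral>\<^sup>+u\<in>?D. \<integral>\<^sup>+v\<in>?D. ennreal ((cmod v)\<^sup>2) *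
        indicator {v. ennreal t < ennreal (1 / cmod v) * disc_proj (G u) v} v \<partial>lborel \<partial>lborel)"
    proof (intro nn_integral_cong)
      fix u
      show "(\<integral>\<^sup>+v. ennreal ((cmod v)\<^sup>2) *
        indicator {v. ennreal t < ennreal (1 / cmod v) * disc_proj (G u) v} v * indicator ?D u * indicator ?D v \<partial>lborel)
        = (\<integral>\<^sup>+v\<in>?D. ennreal ((cmod v)\<^sup>2) *
        indicator {v. ennreal t < ennreal (1 / cmod v) * disc_proj (G u) v} v \<partial>lborel) * indicator ?D u"
        by (cases "u \<in> ?D") (simp_all del: mem_ball mem_ball_0)
    qed
    \<comment> \<open>The weak bound in v, with a constant independent of u.\<close>
    also have "\<dots> \<le> (\<integral>\<^sup>+u\<in>?D. ennreal (C' / t ^ 4) *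
        (\<integral>\<^sup>+s\<in>?D. G u s ^ 4 * ennreal (1 / (cmod s)\<^sup>2) \<partial>lborel) \<partial>lborel)"
      unfolding C'_def
      by (intro nn_integral_mono mult_right_mono disc_proj_level_integral_le C t G_borel zero_le)
    also have "\<dots> = (\<integral>\<^sup>+u. \<integral>\<^sup>+s. ennreal (C' / t ^ 4) *
        (ennreal ((cmod s)\<^sup>2) * P u s ^ 4 * indicator ?D u * indicator ?D s) \<partial>lborel \<partial>lborel)"
    proof (rule nn_integral_cong)
      fix u :: complex
      \<comment> \<open>The weight restores the Jacobian: |s|^4 / |s|^2 = |s|^2, which also holds at
        s = 0, both sides being 0.\<close>
      have G4: "G u s ^ 4 * ennreal (1 / (cmod s)\<^sup>2) = ennreal ((cmod s)\<^sup>2) * P u s ^ 4" for s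
      proof -
        have "(cmod s) ^ 4 * (1 / (cmod s)\<^sup>2) = (cmod s)\<^sup>2"
          by (simp add: power2_eq_square power4_eq_xxxx)
        then have "ennreal (cmod s) ^ 4 * ennreal (1 / (cmod s)\<^sup>2) = ennreal ((cmod s)\<^sup>2)"
          by (simp only: ennreal_power norm_ge_zero ennreal_mult'[symmetric] zero_le_power)
        moreover have "G u s ^ 4 * ennreal (1 / (cmod s)\<^sup>2) = (ennreal (cmod s) ^ 4 * ennreal (1 / (cmod s)\<^sup>2)) * P u s ^ 4"
          by (simp only: G_def power_mult_distrib mult_ac)
        ultimately show ?thesis by simp
      qed
      show "ennreal (C' / t ^ 4) * (\<integral>\<^sup>+s\<in>?D. G u s ^ 4 * ennreal (1 / (cmod s)\<^sup>2) \<partial>lborel) * indicator ?D u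
         = (\<integral>\<^sup>+s. ennreal (C' / t ^ 4) *
        (ennreal ((cmod s)\<^sup>2) * P u s ^ 4 * indicator ?D u * indicator ?D s) \<partial>lborel)"
      proof (cases "u \<in> ?D")
        case True
        have "(\<integral>\<^sup>+s. ennreal (C' / t ^ 4) * (ennreal ((cmod s)\<^sup>2) * P u s ^ 4 * indicator ?D s) \<partial>lborel)
          = ennreal (C' / t ^ 4) * (\<integral>\<^sup>+s\<in>?D. ennreal ((cmod s)\<^sup>2) * P u s ^ 4 \<partial>lborel)"
          by (rule nn_integral_cmult) measurable
        then show ?thesis unfolding G4 using True by simp
      qed simp
    qed
    also have "\<dots> = (\<integral>\<^sup>+s. \<integral>\<^sup>+u. ennreal (C' / t ^ 4) *
        (ennreal ((cmod s)\<^sup>2) * P u s ^ 4 * indicator ?D u * indicator ?D s) \<partial>lborel \<partial>lborel)"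
      by (rule lborel_pair.Fubini') measurable
    also have "\<dots> = (\<integral>\<^sup>+s. \<integral>\<^sup>+u. (ennreal (C' / t ^ 4) * ennreal ((cmod s)\<^sup>2) * indicator ?D s) *
        (P u s ^ 4 * indicator ?D u) \<partial>lborel \<partial>lborel)"
      by (simp only: mult_ac)
    also have "\<dots> = (\<integral>\<^sup>+s. (ennreal (C' / t ^ 4) * ennreal ((cmod s)\<^sup>2) * indicator ?D s) *
        (\<integral>\<^sup>+u\<in>?D. P u s ^ 4 \<partial>lborel) \<partial>lborel)"
      by (intro nn_integral_cong nn_integral_cmult) measurable
    \<comment> \<open>The strong bound in u, applied for each s to the slice x \<mapsto> F (x * s,
      s).\<close>
    also have "\<dots> \<le> (\<integral>\<^sup>+s. (ennreal (C' / t ^ 4) * ennreal ((cmod s)\<^sup>2) * indicator ?D s) *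
        (ennreal C * (\<integral>\<^sup>+x\<in>?D. F (x * s, s) ^ 4 \<partial>lborel)) \<partial>lborel)"
      unfolding P_def by (intro nn_integral_mono mult_left_mono C) auto
    also have "\<dots> = (\<integral>\<^sup>+s. (ennreal (C' / t ^ 4) * ennreal C) *
        ((\<integral>\<^sup>+x\<in>?D. ennreal ((cmod s)\<^sup>2) * F (x * s, s) ^ 4 \<partial>lborel) * indicator ?D s) \<partial>lborel)"
    proof (intro nn_integral_cong)
      fix s
      have "(\<integral>\<^sup>+x\<in>?D. ennreal ((cmod s)\<^sup>2) * F (x * s, s) ^ 4 \<partial>lborel)
        = ennreal ((cmod s)\<^sup>2) * (\<integral>\<^sup>+x\<in>?D. F (x * s, s) ^ 4 \<partial>lborel)"
        by (simp only: mult.assoc, rule nn_integral_cmult) measurable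
      then show "(ennreal (C' / t ^ 4) * ennreal ((cmod s)\<^sup>2) * indicator ?D s) *
        (ennreal C * (\<integral>\<^sup>+x\<in>?D. F (x * s, s) ^ 4 \<partial>lborel))
        = (ennreal (C' / t ^ 4) * ennreal C) *
        ((\<integral>\<^sup>+x\<in>?D. ennreal ((cmod s)\<^sup>2) * F (x * s, s) ^ 4 \<partial>lborel) * indicator ?D s)"
        by (simp only: mult_ac)
    qed
    also have "\<dots> = (ennreal (C' / t ^ 4) * ennreal C) *
        (\<integral>\<^sup>+s\<in>?D. (\<integral>\<^sup>+x\<in>?D. ennreal ((cmod s)\<^sup>2) * F (x * s, s) ^ 4 \<partial>lborel) \<partial>lborel)"
      by (rule nn_integral_cmult) measurable
    also have "(\<integral>\<^sup>+s\<in>?D. (\<integral>\<^sup>+x\<in>?D. ennreal ((cmod s)\<^sup>2) * F (x * s, s) ^ 4 \<partial>lborel) \<partial>lborel)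
       = (\<integral>\<^sup>+z\<in>hartogs. F z ^ 4 \<partial>lborel)"
      by (rule nn_integral_hartogs[symmetric]) measurable
    also have "ennreal (C' / t ^ 4) * ennreal C = ennreal (C' * C / t ^ 4)"
      using C C' t by (simp add: ennreal_mult[symmetric])
    finally show "emeasure lborel {z \<in> hartogs. ennreal t < hartogs_proj F z}
       \<le> ennreal (C' * C / t ^ 4) * (\<integral>\<^sup>+z\<in>hartogs. F z ^ 4 \<partial>lborel)" .
  qed
qed

section \<open>From Lebesgue measurable functions to Borel representatives\<close>

lemma completion_ex_borel_measurable_complex:
  fixes f :: "'a \<Rightarrow> complex"
  assumes [measurable]: "f \<in> borel_measurable (completion M)"
  shows "\<exists>g\<in>borel_measurable M. AE x in M. f x = g x"
proof -
  obtain g1 where g1: "g1 \<in> borel_measurable M" "AE x in M. Re (f x) = g1 x"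
    using completion_ex_borel_measurable_real[of "\<lambda>x. Re (f x)" M] by auto
  obtain g2 where g2: "g2 \<in> borel_measurable M" "AE x in M. Im (f x) = g2 x"
    using completion_ex_borel_measurable_real[of "\<lambda>x. Im (f x)" M] by auto
  have "AE x in M. f x = Complex (g1 x) (g2 x)"
    using g1(2) g2(2) by eventually_elim (simp add: complex_eq_iff)
  then show ?thesis using g1(1) g2(1) by (intro bexI[of _ "\<lambda>x. Complex (g1 x) (g2 x)"]) auto
qed

text \<open>The positive operator is estimated for Borel functions, whereas f is only Lebesgue
  measurable. A Borel function g equal almost everywhere to f cut off to the Hartogs triangle
  changes neither the projection nor the norm. As g is Borel, the projection is an integral of a
  jointly measurable function and hence Borel in z.\<close>

lemma L4_H_borel_representative:
  assumes "L4_H f"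
  obtains g where "g \<in> borel_measurable borel"
    and "bergman_proj_H f \<in> borel_measurable borel"
    and "\<And>z. ennreal (cmod (bergman_proj_H f z)) \<le> hartogs_proj (\<lambda>w. ennreal (cmod (g w))) z"
    and "(\<integral>\<^sup>+z\<in>hartogs. ennreal (cmod (g z)) ^ 4 \<partial>lborel) = ennreal (L4_norm_pow4 f)"
proof -
  have f: "(\<lambda>w. indicator hartogs w *\<^sub>R f w) \<in> borel_measurable lebesgue"
    and int: "integrable lebesgue (\<lambda>w. indicator hartogs w *\<^sub>R cmod (f w) ^ 4)"
    using assms by (auto simp: L4_H_def set_borel_measurable_def set_integrable_def)
  obtain g where [measurable]: "g \<in> borel_measurable lborel"
    and g: "AE w in lborel. indicator hartogs w *\<^sub>R f w = g w"
    using completion_ex_borel_measurable_complex[OF f] by blast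
  have [measurable]: "g \<in> borel_measurable borel" by simp
  have AE: "AE w in lebesgue. indicator hartogs w *\<^sub>R f w = g w"
    by (rule AE_completion[OF g])
  \<comment> \<open>The representative may be nonzero outside the triangle, but only on a null
    set.\<close>
  have g0: "AE w in lborel. g w = indicator hartogs w *\<^sub>R g w"
    using g by eventually_elim (auto simp: indicator_def split: if_splits)
  have proj: "bergman_proj_H f z = (LINT w|lborel. bergman_kernel_H z w * g w)" for z
  proof -
    have [measurable]: "(\<lambda>w. bergman_kernel_H z w) \<in> borel_measurable lebesgue"
      by (rule measurable_completion) simp
    have [measurable]: "g \<in> borel_measurable lebesgue"
      by (rule measurable_completion) simp
    have "bergman_proj_H f z = (LINT w|lebesgue. bergman_kernel_H z w * (indicator hartogs w *\<^sub>R f w))"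
      by (simp add: bergman_proj_H_def set_lebesgue_integral_def)
    also have "\<dots> = (LINT w|lebesgue. bergman_kernel_H z w * g w)"
    proof (rule integral_cong_AE)
      show "(\<lambda>w. bergman_kernel_H z w * (indicator hartogs w *\<^sub>R f w)) \<in> borel_measurable lebesgue"
        by (rule borel_measurable_times[OF _ f]) simp
      show "(\<lambda>w. bergman_kernel_H z w * g w) \<in> borel_measurable lebesgue"
        by measurable
      show "AE w in lebesgue. bergman_kernel_H z w * (indicator hartogs w *\<^sub>R f w) = bergman_kernel_H z w * g w"
        using AE by eventually_elim simp
    qed
    also have "\<dots> = (LINT w|lborel. bergman_kernel_H z w * g w)"
      by (rule integral_completion) measurable
    finally show ?thesis .
  qed
  show thesis
  proof (rule that)
    show "g \<in> borel_measurable borel" by simp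
    show "bergman_proj_H f \<in> borel_measurable borel"
      unfolding proj[abs_def] by measurable
    show "ennreal (cmod (bergman_proj_H f z)) \<le> hartogs_proj (\<lambda>w. ennreal (cmod (g w))) z" for z
    proof -
      \<comment> \<open>Where the integrand is not integrable the Bochner integral is 0 by
        convention, so the bound survives.\<close>
      have "ennreal (cmod (bergman_proj_H f z)) \<le> (\<integral>\<^sup>+w. ennreal (cmod (bergman_kernel_H z w * g w)) \<partial>lborel)"
        unfolding proj
        by (cases "integrable lborel (\<lambda>w. bergman_kernel_H z w * g w)")
           (auto intro: integral_norm_bound_ennreal simp: not_integrable_integral_eq)
      also have "\<dots> = hartogs_proj (\<lambda>w. ennreal (cmod (g w))) z"
        unfolding hartogs_proj_def
      proof (rule nn_integral_cong_AE)
        show "AE w in lborel. ennreal (cmod (bergman_kernel_H z w * g w))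
           = ennreal (cmod (bergman_kernel_H z w)) * ennreal (cmod (g w)) * indicator hartogs w"
          using g0 by eventually_elim (auto simp: norm_mult ennreal_mult indicator_def split: if_splits)
      qed
      finally show ?thesis .
    qed
    have "ennreal (L4_norm_pow4 f) = (\<integral>\<^sup>+w. ennreal (indicator hartogs w *\<^sub>R cmod (f w) ^ 4) \<partial>lebesgue)"
      unfolding L4_norm_pow4_def set_lebesgue_integral_def
      by (rule nn_integral_eq_integral[symmetric, OF int]) auto
    also have "\<dots> = (\<integral>\<^sup>+w\<in>hartogs. ennreal (cmod (g w)) ^ 4 \<partial>lebesgue)"
    proof (rule nn_integral_cong_AE)
      show "AE w in lebesgue. ennreal (indicator hartogs w *\<^sub>R cmod (f w) ^ 4)
          = ennreal (cmod (g w)) ^ 4 * indicator hartogs w"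
        using AE by eventually_elim (auto simp: indicator_def ennreal_power)
    qed
    also have "\<dots> = (\<integral>\<^sup>+w\<in>hartogs. ennreal (cmod (g w)) ^ 4 \<partial>lborel)"
      by (rule nn_integral_completion)
    finally show "(\<integral>\<^sup>+z\<in>hartogs. ennreal (cmod (g z)) ^ 4 \<partial>lborel) = ennreal (L4_norm_pow4 f)" ..
  qed
qed

text \<open>Measurability of the level set accompanies the estimate because \<open>emeasure\<close>
  is 0 on nonmeasurable sets. The constant is that of the positive operator, whose level sets
  contain those of the projection.\<close>

theorem theorem4p2:
  shows "\<exists>C>0. \<forall>f (t::real). L4_H f \<and> t > 0 \<longrightarrow>
           {z \<in> hartogs. norm (bergman_proj_H f z) > t} \<in> sets lebesgue \<and>
           emeasure lebesgue {z \<in> hartogs. norm (bergman_proj_H f z) > t}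
             \<le> ennreal (C * L4_norm_pow4 f / t ^ 4)"
proof -
  obtain C where C: "C > 0" "\<And>F t. F \<in> borel_measurable borel \<Longrightarrow> t > 0 \<Longrightarrow>
     emeasure lborel {z \<in> hartogs. ennreal t < hartogs_proj F z}
       \<le> ennreal (C / t ^ 4) * (\<integral>\<^sup>+z\<in>hartogs. F z ^ 4 \<partial>lborel)"
    using hartogs_proj_weak_type by blast
  show ?thesis
  proof (intro exI[of _ C] conjI[OF C(1)] allI impI)
    fix f and t :: real
    assume "L4_H f \<and> t > 0"
    then have f: "L4_H f" and t: "t > 0" by auto
    obtain g where [measurable]: "g \<in> borel_measurable borel" "bergman_proj_H f \<in> borel_measurable borel"
      and le: "\<And>z. ennreal (cmod (bergman_proj_H f z)) \<le> hartogs_proj (\<lambda>w. ennreal (cmod (g w))) z"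
      and norm: "(\<integral>\<^sup>+z\<in>hartogs. ennreal (cmod (g z)) ^ 4 \<partial>lborel) = ennreal (L4_norm_pow4 f)"
      using L4_H_borel_representative[OF f] by blast
    let ?S = "{z \<in> hartogs. norm (bergman_proj_H f z) > t}"
    have S: "?S \<in> sets borel" by measurable
    then have "emeasure lebesgue ?S = emeasure lborel ?S" by simp
    also have "\<dots> \<le> emeasure lborel {z \<in> hartogs. ennreal t < hartogs_proj (\<lambda>w. ennreal (cmod (g w))) z}"
    proof (rule emeasure_mono)
      show "?S \<subseteq> {z \<in> hartogs. ennreal t < hartogs_proj (\<lambda>w. ennreal (cmod (g w))) z}"
      proof safe
        fix a b assume "t < cmod (bergman_proj_H f (a, b))"
        then have "ennreal t < ennreal (cmod (bergman_proj_H f (a, b)))"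
          using t by (intro ennreal_lessI) auto
        also note le
        finally show "ennreal t < hartogs_proj (\<lambda>w. ennreal (cmod (g w))) (a, b)" .
      qed
    qed simp
    also have "\<dots> \<le> ennreal (C / t ^ 4) * ennreal (L4_norm_pow4 f)"
      unfolding norm[symmetric] by (rule C) (use t in measurable)
    also have "\<dots> = ennreal (C * L4_norm_pow4 f / t ^ 4)"
      using C(1) t by (simp add: ennreal_mult'[symmetric])
    finally show "?S \<in> sets lebesgue \<and> emeasure lebesgue ?S \<le> ennreal (C * L4_norm_pow4 f / t ^ 4)"
      using S by auto
  qed
qed

end
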